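(* Let $\mu$ and $\nu$ be finite Borel measures on $\mathbb{R}^d$ such that $$\lim_{|\xi|\to\infty}\widehat\mu(\xi)=\lim_{|\xi|\to\infty}\widehat\nu(\xi)=0,$$ and let $A\in\mathbb{R}^{d\times d}$ be a matrix such that $\operatorname{Re}\lambda\neq 0$ for all (complex) eigenvalues $\lambda$ of $A$. For $t\in\mathbb{R}$, let $\nu_t=\exp(tA)\nu$. Then there is at most one $t\in\mathbb{R}$ such that $$\dim_{\mathrm{F}}(\mu+\nu_t)>\min(\dim_{\mathrm{F}}\mu,\ \dim_{\mathrm{F}}\nu).$$
   Context: For a matrix $M\in\mathbb{R}^{d\times d}$, $M\nu$ denotes the image (push-forward) of $\nu$ under the linear map $x\mapsto Mx$; $\exp$ is the matrix exponential. For a finite Borel measure $\mu$ on $\mathbb{R}^d$, $\widehat\mu(\xi)=\int e^{-2\pi i \xi\cdot x}\,d\mu(x)$ for $\xi\in\mathbb{R}^d$. The notation $f(\xi)\lesssim g(\xi)$ means there is a constant $C$ with $|f(\xi)|\le C|g(\xi)|$ for all $\xi$ (negative powers of $|\xi|$ are read as $+\infty$ at $\xi=0$). The Fourier dimension of $\mu$ is $\dim_{\mathrm{F}}\mu=\sup\{s\in[0,d]:\ \widehat\mu(\xi)\lesssim|\xi|^{-s/2}\}$. *)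

theory Defs
  imports "HOL-Analysis.Analysis"
begin

subsection \<open>Matrices\<close>

text \<open>
  The class-based \<open>exp\<close> is not applicable to matrices: the type constructor \<open>vec\<close> carries
  componentwise multiplication.
\<close>

definition matrix_power :: "real ^ 'n ^ 'n \<Rightarrow> nat \<Rightarrow> real ^ 'n ^ 'n" where
  "matrix_power M k = (((**) M) ^^ k) (mat 1)"

definition matrix_exp :: "real ^ 'n ^ 'n \<Rightarrow> real ^ 'n ^ 'n" where
  "matrix_exp M = (\<Sum>k. matrix_power M k /\<^sub>R fact k)"

definition complex_eigenvalue :: "real ^ 'n ^ 'n \<Rightarrow> complex \<Rightarrow> bool" where
  "complex_eigenvalue M z \<longleftrightarrow>
     (\<exists>v :: complex ^ 'n. v \<noteq> 0 \<and> map_matrix complex_of_real M *v v = z *s v)"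

lemma abs_matrix_power_entry_le:
  fixes M :: "real ^ 'n ^ 'n"
  shows "\<bar>matrix_power M k $ i $ j\<bar> \<le> onorm ((*v) M) ^ k"
proof -
  have *: "norm (matrix_power M k *v x) \<le> onorm ((*v) M) ^ k * norm x" for x
  proof (induction k)
    case 0
    then show ?case by (simp add: matrix_power_def)
  next
    case (Suc k)
    have "norm (matrix_power M (Suc k) *v x) = norm (M *v (matrix_power M k *v x))"
      by (simp add: matrix_power_def matrix_vector_mul_assoc)
    also have "\<dots> \<le> onorm ((*v) M) * norm (matrix_power M k *v x)"
      by (rule onorm) (rule matrix_vector_mul_bounded_linear)
    also have "\<dots> \<le> onorm ((*v) M) * (onorm ((*v) M) ^ k * norm x)"
      by (intro mult_left_mono Suc.IH onorm_pos_le matrix_vector_mul_bounded_linear)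
    finally show ?case by (simp add: mult.assoc)
  qed
  have "matrix_power M k $ i $ j = (matrix_power M k *v axis j 1) $ i"
    by (simp add: matrix_vector_mul_component inner_axis)
  also have "\<bar>\<dots>\<bar> \<le> norm (matrix_power M k *v axis j 1)"
    by (rule component_le_norm_cart)
  also have "\<dots> \<le> onorm ((*v) M) ^ k"
    using *[of "axis j 1"] by simp
  finally show ?thesis .
qed

lemma sums_matrix_exp:
  fixes M :: "real ^ 'n ^ 'n"
  shows "(\<lambda>k. matrix_power M k /\<^sub>R fact k) sums matrix_exp M"
proof -
  have entry: "summable (\<lambda>k. (matrix_power M k /\<^sub>R fact k) $ i $ j)" for i j
  proof (rule summable_comparison_test')
    show "summable (\<lambda>k. onorm ((*v) M) ^ k /\<^sub>R fact k)"
      by (rule summable_exp_generic)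
    show "norm ((matrix_power M k /\<^sub>R fact k) $ i $ j) \<le> onorm ((*v) M) ^ k /\<^sub>R fact k"
      if "k \<ge> 0" for k
      using abs_matrix_power_entry_le[of M k i j]
      by (simp add: abs_mult divide_simps)
  qed
  have "(\<lambda>k. matrix_power M k /\<^sub>R fact k) sums
          (\<chi> i j. \<Sum>k. (matrix_power M k /\<^sub>R fact k) $ i $ j)"
    unfolding sums_def
  proof (intro vec_tendstoI)
    fix i j
    show "(\<lambda>n. (\<Sum>k<n. matrix_power M k /\<^sub>R fact k) $ i $ j) \<longlonglongrightarrow>
            (\<chi> i j. \<Sum>k. (matrix_power M k /\<^sub>R fact k) $ i $ j) $ i $ j"
      using summable_LIMSEQ[OF entry[of i j]] by simp
  qed
  then show ?thesis
    unfolding matrix_exp_def using summable_sums sums_summable by blast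
qed


subsection \<open>Measures\<close>

definition measure_add :: "'a measure \<Rightarrow> 'a measure \<Rightarrow> 'a measure" where
  "measure_add M N = measure_of (space M) (sets M) (\<lambda>X. emeasure M X + emeasure N X)"

lemma sets_measure_add [simp]: "sets (measure_add M N) = sets M"
  by (simp add: measure_add_def)

lemma space_measure_add [simp]: "space (measure_add M N) = space M"
  by (simp add: measure_add_def)

lemma emeasure_measure_add:
  assumes "sets M = sets N"
  shows "emeasure (measure_add M N) X = emeasure M X + emeasure N X"
proof (cases "X \<in> sets M")
  case True
  have "countably_additive (sets M) (\<lambda>X. emeasure M X + emeasure N X)"
  proof (rule countably_additiveI)
    fix F :: "nat \<Rightarrow> 'a set"
    assume "range F \<subseteq> sets M" "disjoint_family F" "\<Union> (range F) \<in> sets M"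
    then show "(\<Sum>i. emeasure M (F i) + emeasure N (F i)) =
        emeasure M (\<Union> (range F)) + emeasure N (\<Union> (range F))"
      using assms by (subst suminf_add[symmetric]) (auto simp: suminf_emeasure)
  qed
  then show ?thesis
    unfolding measure_add_def
    by (intro emeasure_measure_of_sigma True sets.sigma_algebra_axioms)
      (simp_all add: positive_def)
next
  case False
  then show ?thesis
    using assms by (simp add: emeasure_notin_sets)
qed

definition fourier_transform :: "'a::euclidean_space measure \<Rightarrow> 'a \<Rightarrow> complex" where
  "fourier_transform \<mu> \<xi> = (\<integral>x. exp (- 2 * pi * \<i> * complex_of_real (\<xi> \<bullet> x)) \<partial>\<mu>)"

text \<open>
  The origin is excluded because \<open>0 powr (- s / 2) = 0\<close>, whereas a negative power of \<open>\<bar>\<xi>\<bar>\<close> is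
  to be read as \<open>+\<infinity>\<close> there. For \<open>s = 0\<close> nothing is lost either, since the transform of a finite
  measure is bounded.
\<close>

definition fourier_decay :: "'a::euclidean_space measure \<Rightarrow> real \<Rightarrow> bool" where
  "fourier_decay \<mu> s \<longleftrightarrow>
     (\<exists>C. \<forall>\<xi>. \<xi> \<noteq> 0 \<longrightarrow> cmod (fourier_transform \<mu> \<xi>) \<le> C * norm \<xi> powr (- s / 2))"

definition fourier_dim :: "'a::euclidean_space measure \<Rightarrow> real" where
  "fourier_dim \<mu> = Sup {s \<in> {0..real DIM('a)}. fourier_decay \<mu> s}"

text \<open>For a finite measure this is the supremum of a nonempty bounded set.\<close>

lemma fourier_decay_0:
  assumes "finite_measure \<mu>"
  shows "fourier_decay \<mu> 0"
proof -
  interpret finite_measure \<mu> by fact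
  have "cmod (fourier_transform \<mu> \<xi>) \<le> measure \<mu> (space \<mu>)" for \<xi>
  proof -
    have "cmod (fourier_transform \<mu> \<xi>)
        \<le> (\<integral>x. cmod (exp (- 2 * pi * \<i> * complex_of_real (\<xi> \<bullet> x))) \<partial>\<mu>)"
      unfolding fourier_transform_def by (rule integral_norm_bound)
    also have "\<dots> = measure \<mu> (space \<mu>)"
      by simp
    finally show ?thesis .
  qed
  then show ?thesis
    unfolding fourier_decay_def by (intro exI[of _ "measure \<mu> (space \<mu>)"]) auto
qed

end

theory Submission
  imports Defs "HOL-Computational_Algebra.Fundamental_Theorem_Algebra"
begin

text \<open>
  If two times \<open>t \<noteq> u\<close> both beat the minimum, then subtracting the two decay estimates shows that
  \<open>g\<close>, the transform of \<open>\<nu>\<close>, satisfies \<open>g x - g (E x) = O(|x| powr (- s / 2))\<close> with \<open>s\<close> above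
  the minimum and \<open>E\<close> the exponential of \<open>(u - t)\<close> times the transpose of \<open>A\<close>. As \<open>E\<close> is
  hyperbolic, there is an \<open>n\<close> such that for every \<open>x\<close> the forward or the backward orbit of \<open>x\<close>
  under \<open>E ^ n\<close> at least doubles its norm in every step; telescoping along that orbit, where \<open>g\<close>
  tends to \<open>0\<close>, turns the estimate into a geometric series and gives \<open>g x = O(|x| powr (- s / 2))\<close>.
  The transform of \<open>\<mu>\<close> then decays at the same rate, a contradiction.

  The invariant splitting of \<open>E\<close> is avoided: the vectors with bounded orbit form an invariant
  subspace, which would contain an eigenvector with purely imaginary eigenvalue if it were
  nonzero. Hence all nonzero orbits are unbounded, and compactness of the unit sphere makes
  this uniform.
\<close>

subsection \<open>The matrix exponential\<close>

lemma matrix_power_add: "matrix_power M (j + k) = matrix_power M j ** matrix_power M k"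
  by (induction j) (simp_all add: matrix_power_def matrix_mul_assoc)

lemma matrix_power_Suc: "matrix_power M (Suc k) = M ** matrix_power M k"
  by (simp add: matrix_power_def)

lemma matrix_mult_power_commute: "M ** matrix_power M k = matrix_power M k ** M"
  using matrix_power_add[of M k 1] by (simp add: matrix_power_def)

lemma scaleR_matrix_mult: "(c *\<^sub>R M) ** N = c *\<^sub>R (M ** N)" for M :: "real ^ 'n ^ 'm"
  by (simp add: vec_eq_iff matrix_matrix_mult_def sum_distrib_left mult.assoc)

lemma matrix_mult_scaleR: "M ** (c *\<^sub>R N) = c *\<^sub>R (M ** N)" for M :: "real ^ 'n ^ 'm"
  by (simp add: vec_eq_iff matrix_matrix_mult_def sum_distrib_left mult_ac)

lemma matrix_power_scaleR: "matrix_power (c *\<^sub>R M) k = c ^ k *\<^sub>R matrix_power M k"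
  by (induction k)
    (simp_all add: matrix_power_def scaleR_matrix_mult matrix_mult_scaleR mult.commute)

lemma matrix_power_transpose: "matrix_power (transpose M) k = transpose (matrix_power M k)"
  for M :: "real ^ 'n ^ 'n"
proof (induction k)
  case 0
  then show ?case by (simp add: matrix_power_def)
next
  case (Suc k)
  then show ?case
    by (simp add: matrix_power_Suc matrix_mult_power_commute[of M] matrix_transpose_mul)
qed

text \<open>A linear map on a finite-dimensional space is bounded, so it passes through the series.
  Facts about the exponential thereby reduce to facts about powers, with \<open>h\<close> a
  transposition, an entry, a multiplication by a fixed matrix or the action on a fixed
  vector.\<close>

lemma linear_sums_matrix_exp:
  fixes h :: "real ^ 'n ^ 'n \<Rightarrow> 'b::real_normed_vector"
  assumes "linear h"
  shows "(\<lambda>k. h (matrix_power M k) /\<^sub>R fact k) sums h (matrix_exp M)"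
proof -
  have "bounded_linear h"
    using assms by (simp add: linear_conv_bounded_linear)
  from bounded_linear.sums[OF this sums_matrix_exp[of M]] show ?thesis
    by (simp add: linear_scale[OF assms])
qed

lemma matrix_exp_transpose: "matrix_exp (transpose M) = transpose (matrix_exp M)"
  for M :: "real ^ 'n ^ 'n"
proof -
  have "linear (transpose :: real ^ 'n ^ 'n \<Rightarrow> real ^ 'n ^ 'n)"
    by (rule linearI) (simp_all add: transpose_def vec_eq_iff)
  from linear_sums_matrix_exp[OF this, of M] show ?thesis
    using sums_matrix_exp[of "transpose M"]
    by (simp add: sums_unique2 matrix_power_transpose)
qed

lemma matrix_exp_0: "matrix_exp (0 :: real ^ 'n ^ 'n) = mat 1"
proof -
  have "matrix_power 0 k = (if k = 0 then mat 1 else (0 :: real ^ 'n ^ 'n))" for k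
    by (cases k) (simp_all add: matrix_power_def)
  then have "(\<lambda>k. matrix_power 0 k /\<^sub>R fact k) = (\<lambda>k. if k = 0 then mat 1 else (0 :: real ^ 'n ^ 'n))"
    by (auto simp: fun_eq_iff)
  then show ?thesis
    using sums_matrix_exp[of "0 :: real ^ 'n ^ 'n"] sums_single[of 0 "\<lambda>_. mat 1 :: real ^ 'n ^ 'n"]
    by (simp add: sums_unique2)
qed

text \<open>Entrywise Cauchy product: each entry of the right-hand side is a finite sum of products
  of two absolutely convergent series. Powers of the same matrix multiply by adding exponents, so
  the convolution collapses to the binomial identity for the scalar exponential.\<close>

lemma matrix_exp_add:
  fixes M :: "real ^ 'n ^ 'n"
  shows "matrix_exp ((s + t) *\<^sub>R M) = matrix_exp (s *\<^sub>R M) ** matrix_exp (t *\<^sub>R M)"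
proof -
  define e where "e r k = (r ^ k /\<^sub>R fact k :: real)" for r k
  define a where "a r i j k = e r k * matrix_power M k $ i $ j" for r i j k
  have sums: "a r i j sums (matrix_exp (r *\<^sub>R M) $ i $ j)" for r i j
  proof -
    have "linear (\<lambda>N :: real ^ 'n ^ 'n. N $ i $ j)"
      by (rule linearI) simp_all
    from linear_sums_matrix_exp[OF this, of "r *\<^sub>R M"] show ?thesis
      by (simp add: a_def[abs_def] e_def matrix_power_scaleR mult_ac)
  qed
  have abs: "summable (\<lambda>k. norm (a r i j k))" for r i j
  proof (rule summable_comparison_test')
    show "summable (\<lambda>k. (\<bar>r\<bar> * onorm ((*v) M)) ^ k /\<^sub>R fact k)"
      by (rule summable_exp_generic)
    show "norm (norm (a r i j k)) \<le> (\<bar>r\<bar> * onorm ((*v) M)) ^ k /\<^sub>R fact k" if "k \<ge> 0" for k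
      using abs_matrix_power_entry_le[of M k i j]
      by (simp add: a_def e_def abs_mult power_mult_distrib power_abs mult_left_mono mult.assoc)
  qed
  have conv: "(\<Sum>l\<in>UNIV. \<Sum>m\<le>k. a s i l m * a t l j (k - m)) = a (s + t) i j k" for i j k
  proof -
    have "(\<Sum>l\<in>UNIV. \<Sum>m\<le>k. a s i l m * a t l j (k - m))
        = (\<Sum>m\<le>k. e s m * e t (k - m) *
            (\<Sum>l\<in>UNIV. matrix_power M m $ i $ l * matrix_power M (k - m) $ l $ j))"
      by (subst sum.swap) (simp add: a_def sum_distrib_left mult_ac)
    also have "\<dots> = (\<Sum>m\<le>k. e s m * e t (k - m) * matrix_power M k $ i $ j)"
    proof (rule sum.cong[OF refl])
      fix m assume "m \<in> {..k}"
      then have "matrix_power M k = matrix_power M m ** matrix_power M (k - m)"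
        by (simp flip: matrix_power_add)
      then show "e s m * e t (k - m) *
            (\<Sum>l\<in>UNIV. matrix_power M m $ i $ l * matrix_power M (k - m) $ l $ j)
          = e s m * e t (k - m) * matrix_power M k $ i $ j"
        by (simp add: matrix_matrix_mult_def)
    qed
    also have "\<dots> = a (s + t) i j k"
      using exp_series_add_commuting[of s t k]
      by (simp add: a_def e_def flip: sum_distrib_right)
    finally show ?thesis .
  qed
  have "matrix_exp ((s + t) *\<^sub>R M) $ i $ j
      = (matrix_exp (s *\<^sub>R M) ** matrix_exp (t *\<^sub>R M)) $ i $ j" for i j
  proof -
    have "(\<lambda>k. \<Sum>l\<in>UNIV. \<Sum>m\<le>k. a s i l m * a t l j (k - m)) sums
        (\<Sum>l\<in>UNIV. (\<Sum>k. a s i l k) * (\<Sum>k. a t l j k))"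
      by (intro sums_sum Cauchy_product_sums abs)
    then have "a (s + t) i j sums (matrix_exp (s *\<^sub>R M) ** matrix_exp (t *\<^sub>R M)) $ i $ j"
      unfolding conv by (simp add: sums_unique[OF sums, symmetric] matrix_matrix_mult_def)
    then show ?thesis
      using sums sums_unique2 by blast
  qed
  then show ?thesis
    by (simp add: vec_eq_iff)
qed

lemma matrix_exp_commute: "M ** matrix_exp (t *\<^sub>R M) = matrix_exp (t *\<^sub>R M) ** M"
  for M :: "real ^ 'n ^ 'n"
proof -
  have "linear (\<lambda>N. M ** N)" "linear (\<lambda>N. N ** M)"
    by (rule linearI;
        simp add: vec_eq_iff matrix_matrix_mult_def sum_distrib_left sum.distrib algebra_simps)+
  from this[THEN linear_sums_matrix_exp, of "t *\<^sub>R M"] show ?thesis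
    by (simp add: matrix_power_scaleR matrix_mult_scaleR scaleR_matrix_mult
        matrix_mult_power_commute sums_unique2)
qed

section \<open>Complex eigenvectors of the exponential and eigenvalues of the transpose\<close>

abbreviation complex_matrix :: "real ^ 'n ^ 'm \<Rightarrow> complex ^ 'n ^ 'm" where
  "complex_matrix \<equiv> map_matrix complex_of_real"

lemma complex_matrix_mult: "complex_matrix (M ** N) = complex_matrix M ** complex_matrix N"
  by (simp add: vec_eq_iff matrix_matrix_mult_def)

lemma complex_matrix_exp_eigenvector:
  fixes M :: "real ^ 'n ^ 'n"
  assumes "complex_matrix M *v v = z *s v"
  shows "complex_matrix (matrix_exp (t *\<^sub>R M)) *v v = exp (of_real t * z) *s v"
proof -
  have pow: "complex_matrix (matrix_power M k) *v v = z ^ k *s v" for k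
  proof (induction k)
    case 0
    have "complex_matrix (mat 1 :: real ^ 'n ^ 'n) = mat 1"
      by (simp add: vec_eq_iff mat_def)
    then show ?case by (simp add: matrix_power_def)
  next
    case (Suc k)
    then show ?case
      by (simp add: matrix_power_Suc complex_matrix_mult assms vec.scale mult.commute
          flip: matrix_vector_mul_assoc)
  qed
  have "(complex_matrix (matrix_exp (t *\<^sub>R M)) *v v) $ i = (exp (of_real t * z) *s v) $ i" for i
  proof -
    have scale: "(complex_matrix (c *\<^sub>R N) *v v) $ i = c *\<^sub>R (complex_matrix N *v v) $ i" for c N
      by (simp add: matrix_vector_mult_def scaleR_sum_right, simp add: scaleR_conv_of_real mult.assoc)
    have "linear (\<lambda>N. (complex_matrix N *v v) $ i)"
      by (rule linearI, simp add: matrix_vector_mult_def distrib_right sum.distrib, rule scale)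
    moreover have "(complex_matrix (matrix_power (t *\<^sub>R M) k) *v v) $ i /\<^sub>R fact k
        = (of_real t * z) ^ k /\<^sub>R fact k * v $ i" for k
      by (simp add: matrix_power_scaleR scale pow)
        (simp add: power_mult_distrib scaleR_conv_of_real mult_ac)
    ultimately have "(\<lambda>k. (of_real t * z) ^ k /\<^sub>R fact k * v $ i) sums
        (complex_matrix (matrix_exp (t *\<^sub>R M)) *v v) $ i"
      using linear_sums_matrix_exp[of "\<lambda>N. (complex_matrix N *v v) $ i" "t *\<^sub>R M"] by simp
    moreover have "(\<lambda>k. (of_real t * z) ^ k /\<^sub>R fact k * v $ i) sums (exp (of_real t * z) * v $ i)"
      by (intro sums_mult2 exp_converges)
    ultimately show ?thesis
      by (simp add: sums_unique2)
  qed
  then show ?thesis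
    by (simp add: vec_eq_iff)
qed

text \<open>Being an eigenvalue means that \<open>det (M - z)\<close> vanishes, and transposition
  preserves determinants. This carries the hypothesis on \<open>A\<close> over to its transpose,
  which is the matrix that acts on frequencies.\<close>

lemma complex_eigenvalue_transpose:
  assumes "complex_eigenvalue (transpose M) z"
  shows "complex_eigenvalue M z"
proof -
  have eq: "complex_eigenvalue N z \<longleftrightarrow> \<not> invertible (complex_matrix N - mat z)"
    for N :: "real ^ 'n ^ 'n"
  proof -
    have "mat z *v v = z *s v" for v :: "complex ^ 'n"
      by (simp add: vec_eq_iff matrix_vector_mult_def mat_def if_distrib[of "\<lambda>x. x * _"] cong: if_cong)
    then have "complex_matrix N *v v = z *s v \<longleftrightarrow> (complex_matrix N - mat z) *v v = 0" for v
      by (simp add: matrix_vector_mult_diff_rdistrib)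
    then show ?thesis
      unfolding complex_eigenvalue_def invertible_left_inverse matrix_left_invertible_ker by blast
  qed
  have "complex_matrix (transpose M) - mat z = transpose (complex_matrix M - mat z)"
    by (simp add: vec_eq_iff transpose_def mat_def)
  with assms show ?thesis
    by (simp add: eq invertible_det_nz det_transpose)
qed


subsection \<open>Eigenvectors in invariant subspaces\<close>

text \<open>The vector \<open>p(M) v\<close>, evaluated by Horner's scheme directly on vectors, so
  that no ring structure on matrices enters.\<close>

definition poly_matrix_act :: "complex ^ 'n ^ 'n \<Rightarrow> complex poly \<Rightarrow> complex ^ 'n \<Rightarrow> complex ^ 'n" where
  "poly_matrix_act M p v = fold_coeffs (\<lambda>a w. a *s v + M *v w) p 0"

lemma poly_matrix_act_0 [simp]: "poly_matrix_act M 0 v = 0"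
  by (simp add: poly_matrix_act_def)

lemma poly_matrix_act_pCons [simp]:
  "poly_matrix_act M (pCons a p) v = a *s v + M *v poly_matrix_act M p v"
  by (cases "p = 0 \<and> a = 0") (auto simp: poly_matrix_act_def)

lemma poly_matrix_act_add:
  "poly_matrix_act M (p + q) v = poly_matrix_act M p v + poly_matrix_act M q v"
  by (induction p q rule: poly_induct2)
    (simp_all add: vec.scale_left_distrib matrix_vector_right_distrib)

lemma poly_matrix_act_smult: "poly_matrix_act M (smult c p) v = c *s poly_matrix_act M p v"
  by (induction p) (simp_all add: vec.scale_right_distrib vec.scale)

lemma poly_matrix_act_sum:
  "poly_matrix_act M (\<Sum>i\<in>I. p i) v = (\<Sum>i\<in>I. poly_matrix_act M (p i) v)"
  by (induction I rule: infinite_finite_induct) (simp_all add: poly_matrix_act_add)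

lemma poly_matrix_act_monom: "poly_matrix_act M (monom c i) v = c *s (((*v) M) ^^ i) v"
  by (induction i) (simp_all add: monom_0 monom_Suc vec.scale)

text \<open>More iterates of \<open>v\<close> than the real dimension cannot be independent, and a
  real linear relation among them is an annihilating polynomial.\<close>

lemma annihilating_poly_exists:
  fixes M :: "complex ^ 'n ^ 'n"
  shows "\<exists>p. p \<noteq> 0 \<and> poly_matrix_act M p v = 0"
proof -
  let ?n = "DIM(complex ^ 'n)" and ?w = "\<lambda>i. (((*v) M) ^^ i) v"
  show ?thesis
  proof (cases "inj_on ?w {..?n}")
    \<comment> \<open>Dependence is a property of sets and does not see repeated iterates; a
      coincidence of the iterates \<open>i\<close> and \<open>j\<close> is therefore treated apart,
      by the polynomial \<open>X^i - X^j\<close>.\<close>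
    case False
    then obtain i j where ij: "i \<noteq> j" "?w i = ?w j"
      unfolding inj_on_def by blast
    have "coeff (monom 1 i + monom (-1) j) i \<noteq> (0 :: complex)"
      using ij by simp
    then have "monom 1 i + monom (-1) j \<noteq> (0 :: complex poly)"
      by force
    moreover have "poly_matrix_act M (monom 1 i + monom (-1) j) v = 0"
      by (simp add: poly_matrix_act_add poly_matrix_act_monom ij(2))
    ultimately show ?thesis
      by blast
  next
    case True
    then have "card (?w ` {..?n}) = Suc ?n"
      by (simp add: card_image)
    then have "dependent (?w ` {..?n})"
      using independent_bound by fastforce
    then obtain u where u: "\<exists>x\<in>?w ` {..?n}. u x \<noteq> 0" "(\<Sum>x\<in>?w ` {..?n}. u x *\<^sub>R x) = 0"
      by (auto simp: dependent_finite)
    define p where "p = (\<Sum>i\<le>?n. monom (complex_of_real (u (?w i))) i)"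
    have "poly_matrix_act M p v = (\<Sum>i\<le>?n. u (?w i) *\<^sub>R ?w i)"
      unfolding p_def poly_matrix_act_sum poly_matrix_act_monom
      by (intro sum.cong refl) (simp add: vec_eq_iff, simp add: scaleR_conv_of_real)
    also have "\<dots> = 0"
      using u(2) by (subst (asm) sum.reindex[OF True]) simp
    finally have "poly_matrix_act M p v = 0" .
    moreover obtain i where "i \<le> ?n" "u (?w i) \<noteq> 0"
      using u(1) by blast
    then have "coeff p i \<noteq> 0"
      by (simp add: p_def coeff_sum)
    then have "p \<noteq> 0"
      by force
    ultimately show ?thesis
      by blast
  qed
qed

text \<open>Take a nonzero \<open>p\<close> of least degree with \<open>p(M) v = 0\<close> and split
  off a root, \<open>p = (X - z) q\<close>. By minimality \<open>q(M) v\<close> is nonzero, it is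
  killed by \<open>M - z\<close>, and it lies in \<open>W\<close> by invariance.\<close>

lemma eigenvector_in_invariant_set:
  fixes M :: "complex ^ 'n ^ 'n"
  assumes "v \<in> W" "v \<noteq> 0"
    and zero: "0 \<in> W"
    and add: "\<And>x y. x \<in> W \<Longrightarrow> y \<in> W \<Longrightarrow> x + y \<in> W"
    and scale: "\<And>c x. x \<in> W \<Longrightarrow> c *s x \<in> W"
    and inv: "\<And>x. x \<in> W \<Longrightarrow> M *v x \<in> W"
  obtains w z where "w \<in> W" "w \<noteq> 0" "M *v w = z *s w"
proof -
  have act_in: "poly_matrix_act M p v \<in> W" for p
    by (induction p) (simp_all add: zero add scale inv \<open>v \<in> W\<close>)
  obtain p where p: "p \<noteq> 0" "poly_matrix_act M p v = 0"
    and min: "\<And>q. degree q < degree p \<Longrightarrow> q \<noteq> 0 \<Longrightarrow> poly_matrix_act M q v \<noteq> 0"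
    using exists_least_iff[of "\<lambda>d. \<exists>p. p \<noteq> 0 \<and> poly_matrix_act M p v = 0 \<and> degree p = d"]
      annihilating_poly_exists[of M v] by metis
  have "\<not> constant (poly p)"
  proof
    assume "constant (poly p)"
    then obtain a where a: "p = [:a:]"
      by (metis constant_degree degree_eq_zeroE)
    with p \<open>v \<noteq> 0\<close> show False
      by simp
  qed
  then obtain z where "poly p z = 0"
    using fundamental_theorem_of_algebra by blast
  then obtain q where q: "p = [:- z, 1:] * q"
    by (auto simp: poly_eq_0_iff_dvd)
  with p(1) have "q \<noteq> 0"
    by auto
  have "degree q < degree p"
    unfolding q by (subst degree_mult_eq) (use \<open>q \<noteq> 0\<close> in auto)
  with min \<open>q \<noteq> 0\<close> have "poly_matrix_act M q v \<noteq> 0"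
    by blast
  moreover have "M *v poly_matrix_act M q v = z *s poly_matrix_act M q v"
    using p(2) unfolding q
    by (simp add: poly_matrix_act_add poly_matrix_act_smult flip: smult_minus_left)
  ultimately show ?thesis
    using that act_in by blast
qed

section \<open>Unbounded orbits of hyperbolic exponentials\<close>

lemma norm_vector_scale: "norm (c *s v) = cmod c * norm v" for v :: "complex ^ 'n"
  by (simp add: norm_vec_def norm_mult L2_set_right_distrib)

lemma norm_complexified_vector: "norm (\<chi> i. complex_of_real (x $ i)) = norm x"
  by (simp add: norm_vec_def)

text \<open>If \<open>x\<close> had a bounded orbit, some complex eigenvector would have one too.
  There the norm is multiplied by \<open>exp (k * T * Re z)\<close>, which is unbounded over the
  integers \<open>k\<close> of both signs unless \<open>Re z = 0\<close>.\<close>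

lemma hyperbolic_orbit_unbounded:
  fixes M :: "real ^ 'n ^ 'n"
  assumes hyp: "\<And>z. complex_eigenvalue M z \<Longrightarrow> Re z \<noteq> 0"
    and "T \<noteq> 0" "x \<noteq> 0"
  shows "\<exists>k::int. norm (matrix_exp ((k * T) *\<^sub>R M) *v x) > C"
proof (rule ccontr)
  assume "\<not> ?thesis"
  then have bounded: "norm (matrix_exp ((of_int k * T) *\<^sub>R M) *v x) \<le> C" for k :: int
    by (simp add: not_less)
  let ?c = "\<lambda>x. \<chi> i. complex_of_real (x $ i)"
  let ?F = "\<lambda>k::int. complex_matrix (matrix_exp ((k * T) *\<^sub>R M))"
  \<comment> \<open>The bound may depend on the vector; this is what makes \<open>W\<close> a
    complex subspace. It is invariant because the matrix commutes with its exponentials.\<close>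
  define W where "W = {v. \<exists>C. \<forall>k. norm (?F k *v v) \<le> C}"
  have "?F k *v ?c x = ?c (matrix_exp ((of_int k * T) *\<^sub>R M) *v x)" for k
    by (simp add: vec_eq_iff matrix_vector_mult_def)
  then have "?c x \<in> W"
    using bounded by (auto simp: W_def norm_complexified_vector)
  moreover have "?c x \<noteq> 0"
    using \<open>x \<noteq> 0\<close> norm_complexified_vector[of x] by force
  moreover have "0 \<in> W"
    by (auto simp: W_def)
  moreover have "v + w \<in> W" if "v \<in> W" "w \<in> W" for v w
  proof -
    from that obtain C D where "\<And>k. norm (?F k *v v) \<le> C" "\<And>k. norm (?F k *v w) \<le> D"
      by (auto simp: W_def)
    then have "norm (?F k *v (v + w)) \<le> C + D" for k
      by (simp add: matrix_vector_right_distrib norm_triangle_mono)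
    then show ?thesis
      unfolding W_def by blast
  qed
  moreover have "c *s v \<in> W" if "v \<in> W" for c v
  proof -
    from that obtain C where "\<And>k. norm (?F k *v v) \<le> C"
      by (auto simp: W_def)
    then have "norm (?F k *v (c *s v)) \<le> cmod c * C" for k
      by (simp add: vec.scale norm_vector_scale mult_left_mono)
    then show ?thesis
      unfolding W_def by blast
  qed
  moreover have "complex_matrix M *v v \<in> W" if "v \<in> W" for v
  proof -
    from that obtain C where C: "\<And>k. norm (?F k *v v) \<le> C"
      by (auto simp: W_def)
    have lin: "bounded_linear ((*v) (complex_matrix M))"
      by simp
    have "norm (?F k *v (complex_matrix M *v v)) \<le> onorm ((*v) (complex_matrix M)) * C" for k
    proof -
      have "?F k *v (complex_matrix M *v v) = complex_matrix M *v (?F k *v v)"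
        by (simp add: matrix_vector_mul_assoc matrix_exp_commute flip: complex_matrix_mult)
      then have "norm (?F k *v (complex_matrix M *v v))
          \<le> onorm ((*v) (complex_matrix M)) * norm (?F k *v v)"
        using onorm[OF lin] by simp
      also have "\<dots> \<le> onorm ((*v) (complex_matrix M)) * C"
        by (intro mult_left_mono C onorm_pos_le lin)
      finally show ?thesis .
    qed
    then show ?thesis
      unfolding W_def by blast
  qed
  ultimately obtain v z where v: "v \<in> W" "v \<noteq> 0" and eig: "complex_matrix M *v v = z *s v"
    by (rule eigenvector_in_invariant_set)
  then have "Re z \<noteq> 0"
    using hyp complex_eigenvalue_def by blast
  from v obtain C where C: "\<And>k. norm (?F k *v v) \<le> C"
    by (auto simp: W_def)
  have exp: "exp (of_int k * (T * Re z)) * norm v \<le> C" for k :: int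
    using C[of k] by (simp add: complex_matrix_exp_eigenvector[OF eig] norm_vector_scale mult.assoc)
  obtain n :: nat where n: "of_nat n * \<bar>T * Re z\<bar> > C / norm v"
    using \<open>Re z \<noteq> 0\<close> \<open>T \<noteq> 0\<close> ex_less_of_nat_mult[of "\<bar>T * Re z\<bar>"] by auto
  \<comment> \<open>The sign of \<open>k\<close> is chosen to make the exponent nonnegative.\<close>
  define k where "k = (if T * Re z > 0 then int n else - int n)"
  have k: "of_int k * (T * Re z) = of_nat n * \<bar>T * Re z\<bar>"
    by (auto simp: k_def)
  from n have "C / norm v < exp (of_int k * (T * Re z))"
    unfolding k using exp_ge_add_one_self[of "of_nat n * \<bar>T * Re z\<bar>"] by linarith
  with exp[of k] v(2) show False
    by (simp add: divide_less_eq)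
qed


subsection \<open>Linear actions of the integers without bounded orbits\<close>

locale linear_int_action =
  fixes F :: "int \<Rightarrow> 'a::euclidean_space \<Rightarrow> 'a"
  assumes linear: "linear (F k)"
    and zero: "F 0 x = x"
    and add: "F (j + k) x = F j (F k x)"
begin

lemma inverse: "F (- k) (F k x) = x" "F k (F (- k) x) = x"
  by (simp_all add: zero flip: add)

lemma eq_0_iff: "F k x = 0 \<longleftrightarrow> x = 0"
  by (metis inverse(1) linear linear_0)

lemma norm_bound: obtains L where "L > 0" "\<And>x. norm (F k x) \<le> L * norm x"
  using linear_bounded_pos[OF linear] by blast

lemma norm_bound_finite:
  assumes "finite K"
  obtains L where "L \<ge> 1" "\<And>k x. k \<in> K \<Longrightarrow> norm (F k x) \<le> L * norm x"
proof -
  have "\<forall>k. \<exists>L>0. \<forall>x. norm (F k x) \<le> L * norm x"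
    by (metis norm_bound)
  then obtain L where L: "\<And>k. L k > 0" "\<And>k x. norm (F k x) \<le> L k * norm x"
    by metis
  show ?thesis
  proof
    show "1 + (\<Sum>k\<in>K. L k) \<ge> 1"
      using L(1) by (simp add: sum_nonneg less_imp_le)
    show "norm (F k x) \<le> (1 + (\<Sum>k\<in>K. L k)) * norm x" if "k \<in> K" for k x
    proof -
      have "L k \<le> (\<Sum>k\<in>K. L k)"
        using assms that L(1) by (intro member_le_sum) (auto simp: less_imp_le)
      then have "L k * norm x \<le> (1 + (\<Sum>k\<in>K. L k)) * norm x"
        by (intro mult_right_mono) auto
      with L(2) show ?thesis
        by (rule order_trans)
    qed
  qed
qed

text \<open>The open sets where \<open>norm (F k x) > 2\<close> cover the unit sphere, so by
  compactness finitely many \<open>k\<close> suffice; homogeneity extends this to all nonzero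
  \<open>x\<close>.\<close>

lemma uniform_escape_time:
  assumes unbounded: "\<And>C x. x \<noteq> 0 \<Longrightarrow> \<exists>k. norm (F k x) > C"
  obtains N :: nat where "\<And>x. x \<noteq> 0 \<Longrightarrow> \<exists>k. \<bar>k\<bar> \<le> int N \<and> norm (F k x) > 2 * norm x"
proof -
  have "continuous_on UNIV (\<lambda>x. norm (F k x))" for k
    using linear by (intro continuous_on_norm linear_continuous_on)
      (simp add: linear_conv_bounded_linear)
  then have "open {x. norm (F k x) > 2}" for k
    by (intro open_Collect_less continuous_on_const)
  moreover have "sphere 0 1 \<subseteq> (\<Union>k\<in>UNIV. {x. norm (F k x) > 2})"
  proof
    fix x :: 'a assume "x \<in> sphere 0 1"
    then have "x \<noteq> 0"
      by auto
    with unbounded show "x \<in> (\<Union>k\<in>UNIV. {x. norm (F k x) > 2})"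
      by blast
  qed
  ultimately obtain K where K: "finite K" "sphere 0 1 \<subseteq> (\<Union>k\<in>K. {x. norm (F k x) > 2})"
    using compactE_image[OF compact_sphere, of UNIV "\<lambda>k. {x. norm (F k x) > 2}"]
    by metis
  define N where "N = (\<Sum>k\<in>K. nat \<bar>k\<bar>)"
  show ?thesis
  proof
    fix x :: 'a assume x: "x \<noteq> 0"
    then have "x /\<^sub>R norm x \<in> sphere 0 1"
      by simp
    with K obtain k where k: "k \<in> K" "norm (F k (x /\<^sub>R norm x)) > 2"
      by blast
    then have "norm (F k x) > 2 * norm x"
      using x by (simp add: linear_scale[OF linear] field_simps)
    moreover have "nat \<bar>k\<bar> \<le> N"
      unfolding N_def using K(1) k(1) by (intro member_le_sum) auto
    ultimately show "\<exists>k. \<bar>k\<bar> \<le> int N \<and> norm (F k x) > 2 * norm x"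
      by (intro exI[of _ k]) auto
  qed
qed

text \<open>
  Jumping repeatedly to a point of the orbit at which the norm has doubled produces, within
  distance \<open>m * N\<close> in time, a norm at least \<open>2 ^ m\<close> times the initial one. If the norm at both ends of that time
  window were less than doubled, its maximum over the window could only sit within \<open>N\<close> of an
  end, where it is bounded independently of \<open>m\<close>.
\<close>

lemma uniform_doubling:
  assumes unbounded: "\<And>C x. x \<noteq> 0 \<Longrightarrow> \<exists>k. norm (F k x) > C"
  obtains n :: nat where
    "\<And>x. norm (F (int n) x) \<ge> 2 * norm x \<or> norm (F (- int n) x) \<ge> 2 * norm x"
proof -
  from uniform_escape_time[OF unbounded] obtain N :: nat
    where N: "\<And>x. x \<noteq> 0 \<Longrightarrow> \<exists>k. \<bar>k\<bar> \<le> int N \<and> norm (F k x) > 2 * norm x"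
    by metis
  obtain L where L: "L \<ge> 1" "\<And>k x. k \<in> {- int N..int N} \<Longrightarrow> norm (F k x) \<le> L * norm x"
    using norm_bound_finite[of "{- int N..int N}"] by auto
  \<comment> \<open>The growth \<open>2 ^ m\<close> must still leave a factor of more than
    \<open>2\<close> after a loss of \<open>L\<close>, the price of moving from the maximum to an
    end of the window.\<close>
  obtain m where m: "2 * L < 2 ^ m"
    using real_arch_pow[of 2 "2 * L"] by auto
  have growth: "\<exists>j. \<bar>j\<bar> \<le> int (i * N) \<and> norm (F j x) \<ge> 2 ^ i * norm x" for i x
  proof (induction i)
    case 0
    then show ?case
      by (intro exI[of _ 0]) (simp add: zero)
  next
    case (Suc i)
    then obtain j where j: "\<bar>j\<bar> \<le> int (i * N)" "norm (F j x) \<ge> 2 ^ i * norm x"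
      by blast
    show ?case
    proof (cases "x = 0")
      case True
      then show ?thesis
        by (intro exI[of _ 0]) simp
    next
      case False
      then obtain k where k: "\<bar>k\<bar> \<le> int N" "norm (F k (F j x)) > 2 * norm (F j x)"
        using N eq_0_iff by blast
      with j have "norm (F (k + j) x) \<ge> 2 ^ Suc i * norm x"
        by (simp add: add)
      moreover have "\<bar>k + j\<bar> \<le> int (Suc i * N)"
        using j(1) k(1) by (simp add: algebra_simps)
      ultimately show ?thesis
        by blast
    qed
  qed
  let ?n = "int (m * N)"
  show ?thesis
  proof
    fix x
    show "norm (F ?n x) \<ge> 2 * norm x \<or> norm (F (- ?n) x) \<ge> 2 * norm x"
    proof (cases "x = 0")
      case True
      then show ?thesis
        by simp
    next
      case False
      define S where "S = (\<lambda>j. norm (F j x)) ` {- ?n..?n}"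
      have S: "finite S" "S \<noteq> {}"
        by (auto simp: S_def)
      obtain j where j: "j \<in> {- ?n..?n}" and max: "norm (F j x) = Max S"
        using Max_in[OF S] that unfolding S_def by (metis (no_types, lifting) imageE)
      have le_max: "norm (F i x) \<le> norm (F j x)" if "i \<in> {- ?n..?n}" for i
        unfolding max using S that by (intro Max_ge) (auto simp: S_def)
      obtain i where "\<bar>i\<bar> \<le> ?n" "norm (F i x) \<ge> 2 ^ m * norm x"
        using growth by blast
      then have large: "norm (F j x) \<ge> 2 ^ m * norm x"
        using le_max[of i] by (simp add: abs_le_iff)
      have "F j x \<noteq> 0"
        using False eq_0_iff by blast
      then obtain k where k: "\<bar>k\<bar> \<le> int N" "norm (F k (F j x)) > 2 * norm (F j x)"
        using N by blast
      have "norm (F (k + j) x) > norm (F j x)"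
        using k(2) \<open>F j x \<noteq> 0\<close> by (simp add: add) (smt (verit) norm_ge_zero)
      then have "k + j \<notin> {- ?n..?n}"
        using le_max by force
      \<comment> \<open>From the maximum at \<open>j\<close>, a jump of length at most
        \<open>N\<close> leaves the window, so \<open>j\<close> lies within \<open>N\<close> of one
        of the ends; \<open>e\<close> names that end.\<close>
      then consider "\<bar>j - ?n\<bar> \<le> int N" | "\<bar>j + ?n\<bar> \<le> int N"
        using j k(1) by fastforce
      then obtain e where e: "e = ?n \<or> e = - ?n" "j - e \<in> {- int N..int N}"
      proof cases
        case 1
        then show ?thesis
          by (intro that[of ?n]) (auto simp: abs_le_iff)
      next
        case 2
        then show ?thesis
          by (intro that[of "- ?n"]) (auto simp: abs_le_iff)
      qed
      have "F j x = F (j - e) (F e x)"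
        by (simp flip: add)
      with L(2)[OF e(2)] large have "2 ^ m * norm x \<le> L * norm (F e x)"
        by (metis order_trans)
      moreover have "2 * L * norm x < 2 ^ m * norm x"
        using m False by simp
      ultimately have "L * (2 * norm x) < L * norm (F e x)"
        by (simp add: mult.assoc mult.left_commute)
      then have "2 * norm x < norm (F e x)"
        using L(1) by simp
      with e(1) show ?thesis
        by auto
    qed
  qed
qed

end

section \<open>Functions with power decay\<close>

text \<open>The estimate of \<open>fourier_decay\<close> for arbitrary functions: the argument
  applies it to differences of transforms, composed with linear maps, which need not be transforms
  of measures.\<close>

definition power_decay :: "('a::real_normed_vector \<Rightarrow> complex) \<Rightarrow> real \<Rightarrow> bool" where
  "power_decay f s \<longleftrightarrow> (\<exists>C. \<forall>x. x \<noteq> 0 \<longrightarrow> cmod (f x) \<le> C * norm x powr (- s / 2))"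

lemma power_decay_add:
  assumes "power_decay f s" "power_decay g s"
  shows "power_decay (\<lambda>x. f x + g x) s"
proof -
  from assms obtain C D where
    "\<And>x. x \<noteq> 0 \<Longrightarrow> cmod (f x) \<le> C * norm x powr (- s / 2)"
    "\<And>x. x \<noteq> 0 \<Longrightarrow> cmod (g x) \<le> D * norm x powr (- s / 2)"
    unfolding power_decay_def by metis
  then have "x \<noteq> 0 \<Longrightarrow> cmod (f x + g x) \<le> (C + D) * norm x powr (- s / 2)" for x
    unfolding distrib_right by (intro norm_triangle_mono)
  then show ?thesis
    unfolding power_decay_def by blast
qed

lemma power_decay_minus: "power_decay (\<lambda>x. - f x) s \<longleftrightarrow> power_decay f s"
  by (simp add: power_decay_def)

lemma power_decay_diff:
  assumes "power_decay f s" "power_decay g s"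
  shows "power_decay (\<lambda>x. f x - g x) s"
  using power_decay_add[of f s "\<lambda>x. - g x"] assms by (simp add: power_decay_minus)

text \<open>An injective linear map satisfies \<open>norm (h x) >= c * norm x\<close> with
  \<open>c > 0\<close>, and the exponent \<open>- s / 2\<close> is nonpositive.\<close>

lemma power_decay_compose:
  fixes h :: "'a::euclidean_space \<Rightarrow> 'b::euclidean_space"
  assumes "power_decay f s" "s \<ge> 0" and "inj h" "linear h"
  shows "power_decay (\<lambda>x. f (h x)) s"
proof -
  obtain c where c: "c > 0" "\<And>x. c * norm x \<le> norm (h x)"
    using linear_inj_bounded_below_pos[OF assms(4,3)] by metis
  from assms(1) obtain C where C: "\<And>x. x \<noteq> 0 \<Longrightarrow> cmod (f x) \<le> C * norm x powr (- s / 2)"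
    unfolding power_decay_def by metis
  have "cmod (f (h x)) \<le> (\<bar>C\<bar> * c powr (- s / 2)) * norm x powr (- s / 2)" if "x \<noteq> 0" for x
  proof -
    have "h x \<noteq> 0"
      using c that by (metis mult_pos_pos norm_le_zero_iff not_less zero_less_norm_iff norm_zero)
    then have "cmod (f (h x)) \<le> C * norm (h x) powr (- s / 2)"
      by (rule C)
    also have "\<dots> \<le> \<bar>C\<bar> * norm (h x) powr (- s / 2)"
      by (intro mult_right_mono) auto
    also have "\<dots> \<le> \<bar>C\<bar> * (c * norm x) powr (- s / 2)"
      using that c assms(2) by (intro mult_left_mono powr_mono2') auto
    finally show ?thesis
      using c by (simp add: powr_mult mult.assoc)
  qed
  then show ?thesis
    unfolding power_decay_def by blast
qed

text \<open>Outside the unit ball a smaller exponent only weakens the bound; inside it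
  \<open>norm x powr (- r / 2)\<close> is at least \<open>1\<close>, so boundedness of
  \<open>f\<close> suffices.\<close>

lemma power_decay_mono:
  assumes "power_decay f s" "r \<le> s" "r \<ge> 0" and bounded: "\<And>x. cmod (f x) \<le> B"
  shows "power_decay f r"
proof -
  from assms(1) obtain C where C: "\<And>x. x \<noteq> 0 \<Longrightarrow> cmod (f x) \<le> C * norm x powr (- s / 2)"
    unfolding power_decay_def by metis
  have "B \<ge> 0"
    using bounded norm_ge_zero order_trans by blast
  have "cmod (f x) \<le> (\<bar>C\<bar> + B) * norm x powr (- r / 2)" if "x \<noteq> 0" for x
  proof (cases "norm x \<ge> 1")
    case True
    have "cmod (f x) \<le> C * norm x powr (- s / 2)"
      by (rule C[OF that])
    also have "\<dots> \<le> (\<bar>C\<bar> + B) * norm x powr (- r / 2)"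
      using True \<open>r \<le> s\<close> \<open>B \<ge> 0\<close> by (intro mult_mono powr_mono) auto
    finally show ?thesis .
  next
    case False
    have "1 \<le> norm x powr (- r / 2)"
      using powr_mono2'[of "- r / 2" "norm x" 1] False that \<open>r \<ge> 0\<close> by simp
    then have "(\<bar>C\<bar> + B) * 1 \<le> (\<bar>C\<bar> + B) * norm x powr (- r / 2)"
      using \<open>B \<ge> 0\<close> by (intro mult_left_mono) auto
    moreover have "B \<le> (\<bar>C\<bar> + B) * 1"
      by simp
    ultimately show ?thesis
      using bounded[of x] by (meson order_trans)
  qed
  then show ?thesis
    unfolding power_decay_def by blast
qed

text \<open>Telescope \<open>f\<close> along the orbit. The \<open>k\<close>-th difference is at
  most \<open>C * (2 ^ k * norm x) powr p\<close>, a geometric series of ratio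
  \<open>2 powr p < 1\<close>, and the remainder vanishes because the orbit escapes to
  infinity.\<close>

lemma decay_along_doubling_orbit:
  fixes f :: "'a::real_normed_vector \<Rightarrow> complex"
  assumes lim: "(f \<longlongrightarrow> 0) at_infinity"
    and "p < 0" "C \<ge> 0"
    and diff: "\<And>x. x \<noteq> 0 \<Longrightarrow> cmod (f x - f (g x)) \<le> C * norm x powr p"
    and "x \<noteq> 0" and doubling: "\<And>k. norm ((g ^^ k) x) \<ge> 2 ^ k * norm x"
  shows "cmod (f x) \<le> C / (1 - 2 powr p) * norm x powr p"
proof -
  let ?q = "2 powr p"
  have q: "0 < ?q" "?q < 1"
    using \<open>p < 0\<close> by (auto simp: powr_less_one)
  have step: "cmod (f ((g ^^ k) x) - f ((g ^^ Suc k) x)) \<le> C * norm x powr p * ?q ^ k" for k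
  proof -
    have pos: "2 ^ k * norm x > 0"
      using \<open>x \<noteq> 0\<close> by simp
    with doubling[of k] have "(g ^^ k) x \<noteq> 0"
      by (metis norm_zero not_le)
    from diff[OF this] have "cmod (f ((g ^^ k) x) - f ((g ^^ Suc k) x)) \<le> C * norm ((g ^^ k) x) powr p"
      by simp
    also have "\<dots> \<le> C * (2 ^ k * norm x) powr p"
      using pos doubling[of k] \<open>p < 0\<close> \<open>C \<ge> 0\<close> by (intro mult_left_mono powr_mono2') auto
    also have "\<dots> = C * norm x powr p * ?q ^ k"
      by (simp add: powr_mult powr_powr mult_ac flip: powr_realpow)
    finally show ?thesis .
  qed
  have "cmod (f x) - cmod (f ((g ^^ n) x)) \<le> C / (1 - ?q) * norm x powr p" for n
  proof -
    have "cmod (f x) - cmod (f ((g ^^ n) x)) \<le> cmod (f x - f ((g ^^ n) x))"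
      by (rule norm_triangle_ineq2)
    also have "f x - f ((g ^^ n) x) = (\<Sum>k<n. f ((g ^^ k) x) - f ((g ^^ Suc k) x))"
      using sum_lessThan_telescope'[of "\<lambda>k. f ((g ^^ k) x)" n] by simp
    also have "cmod \<dots> \<le> (\<Sum>k<n. C * norm x powr p * ?q ^ k)"
      by (intro sum_norm_le step)
    also have "\<dots> = C * norm x powr p * (\<Sum>k<n. ?q ^ k)"
      by (simp add: sum_distrib_left)
    also have "\<dots> \<le> C * norm x powr p * (1 / (1 - ?q))"
    proof (rule mult_left_mono)
      show "(\<Sum>k<n. ?q ^ k) \<le> 1 / (1 - ?q)"
        using q by (simp add: sum_gp_strict divide_right_mono del: powr_eq_one_iff_gen powr_eq_one_iff)
    qed (use \<open>C \<ge> 0\<close> in simp)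
    finally show ?thesis
      by simp
  qed
  moreover have "(\<lambda>n. cmod (f x) - cmod (f ((g ^^ n) x))) \<longlonglongrightarrow> cmod (f x) - cmod 0"
  proof (intro tendsto_intros filterlim_compose[OF lim])
    have "filterlim (\<lambda>n. 2 ^ n :: real) at_top sequentially"
      using filterlim_at_infinity_imp_norm_at_top[OF filterlim_realpow_sequentially_gt1[of "2 :: real"]]
      by (simp add: norm_power)
    then have "filterlim (\<lambda>n. 2 ^ n * norm x) at_top sequentially"
      using \<open>x \<noteq> 0\<close> by (intro filterlim_at_top_mult_tendsto_pos[OF tendsto_const]) auto
    then have "filterlim (\<lambda>n. norm ((g ^^ n) x)) at_top sequentially"
      by (rule filterlim_at_top_mono) (simp add: doubling)
    then show "filterlim (\<lambda>n. (g ^^ n) x) at_infinity sequentially"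
      by (simp add: filterlim_at_infinity_conv_norm_at_top)
  qed
  ultimately show ?thesis
    using LIMSEQ_le_const2 by (metis (no_types, lifting) diff_zero norm_zero)
qed

context linear_int_action
begin

lemma inj: "inj (F k)"
  by (metis injI inverse(1))

text \<open>Doubling takes \<open>n\<close> steps in a direction depending on \<open>x\<close>. The
  estimate is therefore extended from \<open>F 1\<close> to \<open>F (int n)\<close> and
  \<open>F (- int n)\<close>, each direction is summed separately, and the two constants are
  added.\<close>

lemma power_decay_orbit:
  assumes unbounded: "\<And>C x. x \<noteq> 0 \<Longrightarrow> \<exists>k. norm (F k x) > C"
    and lim: "(f \<longlongrightarrow> 0) at_infinity"
    and "s > 0" and diff: "power_decay (\<lambda>x. f x - f (F 1 x)) s"
  shows "power_decay f s"
proof -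
  note compose = power_decay_compose[OF _ less_imp_le[OF \<open>s > 0\<close>] inj linear]
  have pos: "power_decay (\<lambda>x. f x - f (F (int k) x)) s" for k
  proof (induction k)
    case 0
    have "power_decay (\<lambda>x. 0) s"
      unfolding power_decay_def by (intro exI[of _ 0]) simp
    then show ?case
      by (simp add: zero)
  next
    case (Suc k)
    from power_decay_add[OF this compose[OF diff, of "int k"]] show ?case
      by (simp add: add flip: add)
  qed
  \<comment> \<open>Substituting \<open>F (- int k) x\<close> into \<open>pos\<close> gives the same
    difference with the opposite sign.\<close>
  have neg: "power_decay (\<lambda>x. f x - f (F (- int k) x)) s" for k
    using compose[OF pos[of k], of "- int k"] power_decay_minus[of "\<lambda>x. f x - f (F (- int k) x)"]
    by (simp add: inverse)
  from uniform_doubling[OF unbounded] obtain n :: nat where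
    n: "\<And>x. norm (F (int n) x) \<ge> 2 * norm x \<or> norm (F (- int n) x) \<ge> 2 * norm x"
    by metis
  have orbit_doubling: "norm ((F e ^^ k) x) \<ge> 2 ^ k * norm x"
    if e: "e = int n \<or> e = - int n" and first: "norm (F e x) \<ge> 2 * norm x" for e k x
  proof -
    \<comment> \<open>A doubling step is followed by another in the same direction. Otherwise the
      choice of \<open>n\<close> at \<open>F e y\<close> makes the step back to \<open>y\<close>
      double the norm, which together with \<open>y\<close> forces \<open>y = 0\<close>.\<close>
    have step: "norm (F e (F e y)) \<ge> 2 * norm (F e y)" if y: "norm (F e y) \<ge> 2 * norm y" for y
    proof (rule ccontr)
      assume *: "\<not> ?thesis"
      with n[of "F e y"] e inverse[of e y] have "norm y \<ge> 2 * norm (F e y)"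
        by (auto simp: inverse)
      with y have "y = 0"
        by (smt (verit) norm_le_zero_iff)
      with * show False
        by (simp add: linear_0[OF linear])
    qed
    have "norm ((F e ^^ k) x) \<ge> 2 ^ k * norm x \<and> norm (F e ((F e ^^ k) x)) \<ge> 2 * norm ((F e ^^ k) x)"
      by (induction k) (use first step in \<open>auto intro: order_trans\<close>)
    then show ?thesis ..
  qed
  have "\<exists>C\<ge>0. \<forall>x. x \<noteq> 0 \<and> norm (F e x) \<ge> 2 * norm x \<longrightarrow> cmod (f x) \<le> C * norm x powr (- s / 2)"
    if e: "e = int n \<or> e = - int n" for e
  proof -
    from e pos neg have "power_decay (\<lambda>x. f x - f (F e x)) s"
      by auto
    then obtain C where "\<And>x. x \<noteq> 0 \<Longrightarrow> cmod (f x - f (F e x)) \<le> C * norm x powr (- s / 2)"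
      unfolding power_decay_def by metis
    then have C: "cmod (f x - f (F e x)) \<le> \<bar>C\<bar> * norm x powr (- s / 2)" if "x \<noteq> 0" for x
      using that by (smt (verit) mult_right_mono powr_ge_zero)
    have "cmod (f x) \<le> \<bar>C\<bar> / (1 - 2 powr (- s / 2)) * norm x powr (- s / 2)"
      if "x \<noteq> 0" "norm (F e x) \<ge> 2 * norm x" for x
      using orbit_doubling[OF e that(2)] \<open>s > 0\<close> C \<open>x \<noteq> 0\<close>
      by (intro decay_along_doubling_orbit[OF lim, where g = "F e"]) auto
    moreover have "2 powr (- s / 2) \<le> 1"
      using \<open>s > 0\<close> powr_mono[of "- s / 2" 0 2] by simp
    then have "\<bar>C\<bar> / (1 - 2 powr (- s / 2)) \<ge> 0"
      by simp
    ultimately show ?thesis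
      by blast
  qed
  from this[of "int n"] this[of "- int n"] obtain C D where
    "C \<ge> 0" "\<And>x. x \<noteq> 0 \<Longrightarrow> norm (F (int n) x) \<ge> 2 * norm x \<Longrightarrow> cmod (f x) \<le> C * norm x powr (- s / 2)"
    "D \<ge> 0" "\<And>x. x \<noteq> 0 \<Longrightarrow> norm (F (- int n) x) \<ge> 2 * norm x \<Longrightarrow> cmod (f x) \<le> D * norm x powr (- s / 2)"
    by metis
  then have "cmod (f x) \<le> (C + D) * norm x powr (- s / 2)" if "x \<noteq> 0" for x
    using n[of x] that by (smt (verit) mult_right_mono powr_ge_zero)
  then show ?thesis
    unfolding power_decay_def by blast
qed

end


subsection \<open>Fourier transforms of sums and images of measures\<close>

lemma nn_integral_measure_add:
  assumes sets: "sets M = sets N" and "f \<in> borel_measurable M"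
  shows "(\<integral>\<^sup>+x. f x \<partial>measure_add M N) = (\<integral>\<^sup>+x. f x \<partial>M) + (\<integral>\<^sup>+x. f x \<partial>N)"
  using assms(2)
proof (induction rule: borel_measurable_induct)
  case (cong f g)
  moreover have "space N = space M"
    using sets by (metis sets_eq_imp_space_eq)
  ultimately show ?case
    by (simp cong: nn_integral_cong_simp)
next
  case (set A)
  then show ?case
    using sets by (simp add: emeasure_measure_add)
next
  case (mult u c)
  then have "u \<in> borel_measurable N" "u \<in> borel_measurable (measure_add M N)"
    using measurable_cong_sets[OF sets refl] measurable_cong_sets[OF sets_measure_add refl] by blast+
  with mult show ?case
    by (simp add: nn_integral_cmult distrib_left)
next
  case (add u v)
  then have "u \<in> borel_measurable N" "v \<in> borel_measurable N"
    "u \<in> borel_measurable (measure_add M N)" "v \<in> borel_measurable (measure_add M N)"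
    using measurable_cong_sets[OF sets refl] measurable_cong_sets[OF sets_measure_add refl] by blast+
  with add show ?case
    by (simp add: nn_integral_add ac_simps)
next
  case (seq U)
  then have meas: "U i \<in> borel_measurable N" "U i \<in> borel_measurable (measure_add M N)" for i
    using measurable_cong_sets[OF sets refl] measurable_cong_sets[OF sets_measure_add refl] by blast+
  have inc: "incseq (\<lambda>i. \<integral>\<^sup>+x. U i x \<partial>K)" for K
    using \<open>incseq U\<close> by (auto simp: incseq_def le_fun_def intro!: nn_integral_mono)
  have "(\<integral>\<^sup>+x. (SUP i. U i x) \<partial>measure_add M N) = (SUP i. \<integral>\<^sup>+x. U i x \<partial>measure_add M N)"
    using seq meas by (intro nn_integral_monotone_convergence_SUP)
  also have "\<dots> = (SUP i. (\<integral>\<^sup>+x. U i x \<partial>M) + (\<integral>\<^sup>+x. U i x \<partial>N))"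
    by (simp add: seq)
  also have "\<dots> = (SUP i. \<integral>\<^sup>+x. U i x \<partial>M) + (SUP i. \<integral>\<^sup>+x. U i x \<partial>N)"
    by (intro ennreal_SUP_add inc)
  also have "\<dots> = (\<integral>\<^sup>+x. (SUP i. U i x) \<partial>M) + (\<integral>\<^sup>+x. (SUP i. U i x) \<partial>N)"
    using seq meas by (simp add: nn_integral_monotone_convergence_SUP)
  finally show ?case
    by (simp add: image_comp)
qed

text \<open>Additivity passes from nonnegative functions to real ones through positive and negative
  parts, and then to vector values coordinate by coordinate.\<close>

lemma integral_measure_add:
  fixes f :: "'a \<Rightarrow> 'b::euclidean_space"
  assumes sets: "sets M = sets N" and "integrable M f" "integrable N f"
  shows "integral\<^sup>L (measure_add M N) f = integral\<^sup>L M f + integral\<^sup>L N f"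
proof -
  have integrable: "integrable (measure_add M N) h"
    if "integrable M h" "integrable N h" for h :: "'a \<Rightarrow> 'c::{banach,second_countable_topology}"
  proof -
    have "h \<in> borel_measurable M" "h \<in> borel_measurable (measure_add M N)"
      using borel_measurable_integrable[OF that(1)] measurable_cong_sets[OF sets_measure_add refl]
      by blast+
    with that show ?thesis
      by (simp add: integrable_iff_bounded nn_integral_measure_add[OF sets])
  qed
  have real: "integral\<^sup>L (measure_add M N) h = integral\<^sup>L M h + integral\<^sup>L N h"
    if h: "integrable M h" "integrable N h" for h :: "'a \<Rightarrow> real"
  proof -
    have [measurable]: "h \<in> borel_measurable M"
      using h by simp
    \<comment> \<open>\<open>enn2real\<close> is additive only on finite values.\<close>
    have fin: "(\<integral>\<^sup>+x. ennreal (h x) \<partial>M) < \<infinity>" "(\<integral>\<^sup>+x. ennreal (h x) \<partial>N) < \<infinity>"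
      "(\<integral>\<^sup>+x. ennreal (- h x) \<partial>M) < \<infinity>" "(\<integral>\<^sup>+x. ennreal (- h x) \<partial>N) < \<infinity>"
      using h by (auto simp: real_integrable_def less_top[symmetric])
    show ?thesis
      using fin unfolding real_lebesgue_integral_def[OF integrable[OF h]]
        real_lebesgue_integral_def[OF h(1)] real_lebesgue_integral_def[OF h(2)]
      by (simp add: nn_integral_measure_add[OF sets] enn2real_plus)
  qed
  show ?thesis
  proof (rule euclidean_eqI)
    fix b :: 'b assume "b \<in> Basis"
    have "integral\<^sup>L (measure_add M N) f \<bullet> b = (\<integral>x. f x \<bullet> b \<partial>measure_add M N)"
      using integrable[OF assms(2,3)] by simp
    also have "\<dots> = (\<integral>x. f x \<bullet> b \<partial>M) + (\<integral>x. f x \<bullet> b \<partial>N)"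
      using assms by (intro real) auto
    also have "\<dots> = (integral\<^sup>L M f + integral\<^sup>L N f) \<bullet> b"
      using assms by (simp add: inner_add_left)
    finally show "integral\<^sup>L (measure_add M N) f \<bullet> b = (integral\<^sup>L M f + integral\<^sup>L N f) \<bullet> b" .
  qed
qed

lemma finite_measure_measure_add:
  assumes "sets M = sets N" "finite_measure M" "finite_measure N"
  shows "finite_measure (measure_add M N)"
proof
  have "space N = space M"
    using assms(1) by (metis sets_eq_imp_space_eq)
  then show "emeasure (measure_add M N) (space (measure_add M N)) \<noteq> \<infinity>"
    using assms(1) finite_measure.emeasure_finite[OF assms(2), of "space M"]
      finite_measure.emeasure_finite[OF assms(3), of "space M"]
    by (simp add: emeasure_measure_add)
qed

lemma integrable_fourier_kernel:
  fixes \<mu> :: "'a::euclidean_space measure"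
  assumes "finite_measure \<mu>" "sets \<mu> = sets borel"
  shows "integrable \<mu> (\<lambda>x. exp (- 2 * pi * \<i> * complex_of_real (\<xi> \<bullet> x)))"
proof (rule finite_measure.integrable_const_bound[OF assms(1)])
  show "AE x in \<mu>. cmod (exp (- 2 * pi * \<i> * complex_of_real (\<xi> \<bullet> x))) \<le> 1"
    by simp
  have "continuous_on UNIV (\<lambda>x. exp (- 2 * pi * \<i> * complex_of_real (\<xi> \<bullet> x)))"
    by (intro continuous_intros)
  then show "(\<lambda>x. exp (- 2 * pi * \<i> * complex_of_real (\<xi> \<bullet> x))) \<in> borel_measurable \<mu>"
    using borel_measurable_continuous_onI measurable_cong_sets[OF assms(2) refl] by blast
qed

lemma fourier_transform_measure_add:
  fixes \<mu> \<nu> :: "'a::euclidean_space measure"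
  assumes "finite_measure \<mu>" "sets \<mu> = sets borel" "finite_measure \<nu>" "sets \<nu> = sets borel"
  shows "fourier_transform (measure_add \<mu> \<nu>) \<xi> = fourier_transform \<mu> \<xi> + fourier_transform \<nu> \<xi>"
  unfolding fourier_transform_def
  using assms by (intro integral_measure_add integrable_fourier_kernel) auto

lemma measurable_matrix_vector_mult:
  "sets \<nu> = sets borel \<Longrightarrow> (*v) M \<in> \<nu> \<rightarrow>\<^sub>M borel" for M :: "real ^ 'n ^ 'm"
  using borel_measurable_continuous_onI[OF linear_continuous_on[OF matrix_vector_mul_bounded_linear]]
  by (metis measurable_cong_sets)

text \<open>Change of variables, then the matrix is moved to the other side of the inner
  product.\<close>

lemma fourier_transform_distr_matrix:
  fixes M :: "real ^ 'n ^ 'm"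
  assumes "sets \<nu> = sets borel"
  shows "fourier_transform (distr \<nu> borel ((*v) M)) \<xi> = fourier_transform \<nu> (transpose M *v \<xi>)"
proof -
  have "continuous_on UNIV (\<lambda>x. exp (- 2 * pi * \<i> * complex_of_real (\<xi> \<bullet> x)))"
    by (intro continuous_intros)
  then show ?thesis
    unfolding fourier_transform_def
    by (subst integral_distr)
      (auto simp: measurable_matrix_vector_mult[OF assms] borel_measurable_continuous_onI
        dot_lmul_matrix simp flip: vector_transpose_matrix)
qed

section \<open>Fourier decay and Fourier dimension\<close>

lemma fourier_decay_iff_power_decay: "fourier_decay \<mu> s \<longleftrightarrow> power_decay (fourier_transform \<mu>) s"
  by (simp add: fourier_decay_def power_decay_def)

lemma fourier_decay_mono:
  assumes "finite_measure \<mu>" "fourier_decay \<mu> s" "r \<le> s" "r \<ge> 0"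
  shows "fourier_decay \<mu> r"
proof -
  have "cmod (fourier_transform \<mu> \<xi>) \<le> measure \<mu> (space \<mu>)" for \<xi>
    using integral_norm_bound[of \<mu> "\<lambda>x. exp (- 2 * pi * \<i> * complex_of_real (\<xi> \<bullet> x))"]
    by (simp add: fourier_transform_def)
  with assms show ?thesis
    unfolding fourier_decay_iff_power_decay by (intro power_decay_mono[of _ s r])
qed

lemma fourier_dim_upper:
  fixes \<mu> :: "'a::euclidean_space measure"
  assumes "fourier_decay \<mu> s" "0 \<le> s" "s \<le> DIM('a)"
  shows "s \<le> fourier_dim \<mu>"
  unfolding fourier_dim_def using assms by (intro cSup_upper bdd_aboveI[of _ "DIM('a)"]) auto

lemma fourier_dim_nonneg: "finite_measure \<mu> \<Longrightarrow> fourier_dim \<mu> \<ge> 0"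
  by (intro fourier_dim_upper fourier_decay_0) auto

lemma less_fourier_dimE:
  fixes \<mu> :: "'a::euclidean_space measure"
  assumes "m < fourier_dim \<mu>" "finite_measure \<mu>"
  obtains s where "m < s" "0 \<le> s" "s \<le> DIM('a)" "fourier_decay \<mu> s"
proof -
  let ?S = "{s \<in> {0..real DIM('a)}. fourier_decay \<mu> s}"
  have "0 \<in> ?S"
    using fourier_decay_0[OF assms(2)] by simp
  then obtain s where "s \<in> ?S" "m < s"
    using less_cSupE[OF assms(1)[unfolded fourier_dim_def]] by blast
  with that show ?thesis
    by simp
qed

section \<open>Integer powers of the exponential and the final contradiction\<close>

lemma linear_int_action_matrix_exp:
  "linear_int_action (\<lambda>k x. matrix_exp ((of_int k * T) *\<^sub>R M) *v x)" for M :: "real ^ 'n ^ 'n"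
  by (rule linear_int_action.intro)
    (simp_all add: matrix_exp_0 matrix_exp_add distrib_right matrix_vector_mul_assoc)

lemma inj_matrix_exp: "inj ((*v) (matrix_exp (t *\<^sub>R M)))" for M :: "real ^ 'n ^ 'n"
  using linear_int_action.inj[OF linear_int_action_matrix_exp, of 1 t M] by simp

theorem proposition16:
  fixes \<mu> \<nu> :: "(real ^ 'n) measure" and A :: "real ^ 'n ^ 'n"
  assumes "finite_measure \<mu>" and "sets \<mu> = sets borel"
    and "finite_measure \<nu>" and "sets \<nu> = sets borel"
    and "(fourier_transform \<mu> \<longlongrightarrow> 0) at_infinity"
    and "(fourier_transform \<nu> \<longlongrightarrow> 0) at_infinity"
    and "\<And>z. complex_eigenvalue A z \<Longrightarrow> Re z \<noteq> 0"
  shows "\<exists>\<^sub>\<le>\<^sub>1 t :: real.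
    fourier_dim (measure_add \<mu> (distr \<nu> borel (\<lambda>x. matrix_exp (t *\<^sub>R A) *v x)))
      > min (fourier_dim \<mu>) (fourier_dim \<nu>)"
proof (rule Uniq_I, rule ccontr)
  let ?m = "min (fourier_dim \<mu>) (fourier_dim \<nu>)" and ?B = "transpose A"
  let ?sum = "\<lambda>t. measure_add \<mu> (distr \<nu> borel (\<lambda>x. matrix_exp (t *\<^sub>R A) *v x))"
  let ?E = "\<lambda>t x. matrix_exp (t *\<^sub>R ?B) *v x"
  let ?f = "fourier_transform \<mu>" and ?g = "fourier_transform \<nu>"
  fix t u assume large: "fourier_dim (?sum t) > ?m" "fourier_dim (?sum u) > ?m" and "u \<noteq> t"
  have m: "?m \<ge> 0"
    using assms by (simp add: fourier_dim_nonneg)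
  have transform: "fourier_transform (?sum r) = (\<lambda>\<xi>. ?f \<xi> + ?g (?E r \<xi>))" for r
  proof
    have "transpose (r *\<^sub>R A) = r *\<^sub>R ?B"
      by (simp add: transpose_def vec_eq_iff)
    then have exp: "transpose (matrix_exp (r *\<^sub>R A)) = matrix_exp (r *\<^sub>R ?B)"
      by (metis matrix_exp_transpose)
    show "fourier_transform (?sum r) \<xi> = ?f \<xi> + ?g (?E r \<xi>)" for \<xi>
      using assms measurable_matrix_vector_mult[OF assms(4), of "matrix_exp (r *\<^sub>R A)"]
      by (subst fourier_transform_measure_add)
        (simp_all add: fourier_transform_distr_matrix exp finite_measure.finite_measure_distr)
  qed
  have fin: "finite_measure (?sum r)" for r
    using assms measurable_matrix_vector_mult[OF assms(4), of "matrix_exp (r *\<^sub>R A)"]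
    by (intro finite_measure_measure_add) (auto simp: finite_measure.finite_measure_distr)
  obtain p q where p: "?m < p" "p \<le> DIM(real ^ 'n)" "fourier_decay (?sum t) p"
    and q: "?m < q" "q \<le> DIM(real ^ 'n)" "fourier_decay (?sum u) q"
    using less_fourier_dimE[OF large(1) fin] less_fourier_dimE[OF large(2) fin] by metis
  \<comment> \<open>A common rate for both sums, still above \<open>?m\<close> and hence positive,
    as the geometric series requires.\<close>
  define s where "s = min p q"
  have s: "?m < s" "s > 0" "s \<le> DIM(real ^ 'n)"
    using p q m by (auto simp: s_def)
  have decay: "power_decay (\<lambda>\<xi>. ?f \<xi> + ?g (?E t \<xi>)) s" "power_decay (\<lambda>\<xi>. ?f \<xi> + ?g (?E u \<xi>)) s"
    using fourier_decay_mono[OF fin p(3), of s] fourier_decay_mono[OF fin q(3), of s] s(2)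
    unfolding fourier_decay_iff_power_decay transform by (auto simp: s_def)
  have compose: "power_decay (\<lambda>\<xi>. h (?E r \<xi>)) s" if "power_decay h s" for h r
    using s(2) by (intro power_decay_compose[OF that _ inj_matrix_exp matrix_vector_mul_linear]) simp
  \<comment> \<open>The transform of \<open>\<mu>\<close> cancels in the difference; composing with
    \<open>?E (- t)\<close> then turns the first term into \<open>?g\<close> itself.\<close>
  have "power_decay (\<lambda>\<xi>. ?g (?E t \<xi>) - ?g (?E u \<xi>)) s"
    using power_decay_diff[OF decay] by simp
  from compose[OF this, of "- t"]
  have "power_decay (\<lambda>\<xi>. ?g (?E t (?E (- t) \<xi>)) - ?g (?E u (?E (- t) \<xi>))) s" .
  moreover have "?E a (?E b \<xi>) = ?E (a + b) \<xi>" for a b \<xi>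
    by (simp add: matrix_vector_mul_assoc matrix_exp_add)
  ultimately have "power_decay (\<lambda>\<xi>. ?g \<xi> - ?g (?E (u - t) \<xi>)) s"
    by (simp add: matrix_exp_0 del: scaleR_minus_left)
  moreover have "\<exists>k::int. norm (?E (k * (u - t)) x) > C" if "x \<noteq> 0" for C x
    using assms(7) complex_eigenvalue_transpose \<open>u \<noteq> t\<close> that
    by (intro hyperbolic_orbit_unbounded) auto
  ultimately have g: "power_decay ?g s"
    using linear_int_action.power_decay_orbit[OF linear_int_action_matrix_exp[of "u - t" ?B] _ assms(6) s(2)]
    by simp
  \<comment> \<open>The decay of \<open>?g\<close> survives composition with \<open>?E t\<close>, so
    it can be subtracted from the estimate for the sum at time \<open>t\<close>.\<close>
  have "power_decay ?f s"
    using power_decay_diff[OF decay(1) compose[OF g, of t]] by simp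
  with g have "s \<le> fourier_dim \<mu>" "s \<le> fourier_dim \<nu>"
    using s by (auto intro!: fourier_dim_upper simp: fourier_decay_iff_power_decay)
  with s(1) show False
    by simp
qed

end
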